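(* Let $0\le \underline{k}\le\overline{k}$ be integers and write $w(n,m)=w_{\underline{k}\le\overline{k}}(n,m)$. For all $n\ge 1$ and $m\ge 0$, $$w(n,m)=2w(n-1,m)+w(n-(\underline{k}+1),m-1)-w(n-(\underline{k}+1),m)-w(n-(\overline{k}+2),m-1)+w(n-(\overline{k}+2),m),$$ with initial values $w(-1,m)=1$ if $m=0$ and $0$ otherwise; $w(0,m)=1$ if ($m=1$ and $\underline{k}=0$) or ($m=0$ and $\underline{k}\geq 1$), and $0$ otherwise; and $w(n,m)=0$ whenever $n<-1$ or $m<0$.
   Context: An $n$-string is a binary string of length $n$. A run of ones is a maximal block of consecutive ones, flanked on each side by a zero or by the start/end of the string. Null runs (length $0$) of ones also count: there is one between every two consecutive zeros, one before an initial zero and one after a final zero; thus a string with $z$ zeros has exactly $z+1$ runs of ones (including null ones), namely the possibly empty blocks of ones delimited by the zeros. For $n\ge 1$, $w_{\underline{k}\le\overline{k}}(n,m)$ is the number of $n$-strings containing exactly $m$ runs of ones whose length lies in $[\underline{k},\overline{k}]$ (null runs included if $\underline{k}=0$; other runs are unrestricted). The values at $n\le 0$ and at $m<0$ are the conventions given in the claim. *)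

theory Defs
  imports Main
begin

text \<open>Binary strings are boolean lists, with \<^term>\<open>True\<close> for the digit one. A run of ones is
  represented by the pair of its start position (inclusive) and its end position (exclusive),
  positions being counted from 0. Pairs of the form \<open>(i, i)\<close> are the null runs; the empty string
  has the single null run \<open>(0, 0)\<close>.\<close>

definition one_runs :: "bool list \<Rightarrow> (nat \<times> nat) set" where
  "one_runs s = {(i, j). i \<le> j \<and> j \<le> length s \<and> (\<forall>l. i \<le> l \<and> l < j \<longrightarrow> s ! l) \<and>
     (i = 0 \<or> \<not> s ! (i - 1)) \<and> (j = length s \<or> \<not> s ! j)}"

definition num_runs_between :: "nat \<Rightarrow> nat \<Rightarrow> bool list \<Rightarrow> nat" where
  "num_runs_between kl ku s = card {(i, j) \<in> one_runs s. kl \<le> j - i \<and> j - i \<le> ku}"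

definition num_strings :: "nat \<Rightarrow> nat \<Rightarrow> nat \<Rightarrow> nat \<Rightarrow> nat" where
  "num_strings kl ku n m = card {s. length s = n \<and> num_runs_between kl ku s = m}"

text \<open>The counting function extended to all integer arguments: the count itself for \<open>n \<ge> 1\<close> and
  \<open>m \<ge> 0\<close>, and conventional values elsewhere.\<close>

definition w :: "nat \<Rightarrow> nat \<Rightarrow> int \<Rightarrow> int \<Rightarrow> int" where
  "w kl ku n m =
    (if n < -1 \<or> m < 0 then 0
     else if n = -1 then (if m = 0 then 1 else 0)
     else if n = 0 then (if (m = 1 \<and> kl = 0) \<or> (m = 0 \<and> kl \<ge> 1) then 1 else 0)
     else int (num_strings kl ku (nat n) (nat m)))"

end

theory Submission
  imports Defs
begin

text \<open>Write \<open>1\<^sup>j\<close> for a block of \<open>j\<close> ones. A string of length \<open>n\<close> is either \<open>1\<^sup>n\<close> or, for a unique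
  \<open>j < n\<close>, the block \<open>1\<^sup>j\<close> followed by a zero and an arbitrary string \<open>t\<close> of length \<open>n - j - 1\<close>.
  In the second case the runs of ones are the block \<open>1\<^sup>j\<close> and the shifted runs of \<open>t\<close>
  (lemma \<open>num_runs_between_block\<close>). Imagine one more zero at the end of every string: then the first
  case becomes an instance of the second, with an empty rest of length \<open>-1\<close>, and the
  value of \<open>w\<close> at \<open>n = -1\<close> is exactly what this reading needs. Hence, for \<open>n \<ge> 0\<close> and every integer
  \<open>m\<close> (lemma \<open>w_first_block\<close>),
  \<open>w(n, m) = (\<Sum>j\<le>n. w(n - j - 1, m - r(j)))\<close>, where \<open>r(j) = 1\<close> if \<open>kl \<le> j \<le> ku\<close> and \<open>r(j) = 0\<close> otherwise.

  Now subtract this identity for \<open>n - 1\<close> from the one for \<open>n\<close>. After aligning first arguments, the terms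
  \<open>w(n - j - 1, m - r(j))\<close> and \<open>w(n - j - 1, m - r(j - 1))\<close> cancel unless \<open>r\<close> jumps between
  \<open>j - 1\<close> and \<open>j\<close>, which happens at \<open>j = kl\<close> (from 0 to 1) and at \<open>j = ku + 1\<close>
  (from 1 to 0). These two jumps give the four correction terms, and the term for \<open>j = 0\<close>,
  with \<open>r(-1)\<close> read as 0, gives the second copy of \<open>w(n - 1, m)\<close>.\<close>

lemma finite_one_runs: "finite (one_runs s)"
  by (rule finite_subset[of _ "{..length s} \<times> {..length s}"]) (auto simp: one_runs_def)

lemma one_runs_replicate_True: "one_runs (replicate n True) = {(0, n)}"
  by (auto simp: one_runs_def)

text \<open>The zero at position \<open>j\<close> separates the runs: a run that starts at or before it must start
  at 0, since the digit before any other such start is a one, and must then end at \<open>j\<close>.\<close>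

lemma one_runs_block:
  "one_runs (replicate j True @ False # t) =
     insert (0, j) ((\<lambda>(a, b). (a + Suc j, b + Suc j)) ` one_runs t)" (is "one_runs ?s = ?R")
proof (rule set_eqI, clarify)
  fix a b
  have nth: "?s ! i \<longleftrightarrow> i < j \<or> (j < i \<and> t ! (i - Suc j))" if "i < length ?s" for i
    using that by (auto simp: nth_append nth_Cons')
  show "(a, b) \<in> one_runs ?s \<longleftrightarrow> (a, b) \<in> ?R"
  proof (cases "a \<le> j")
    case True
    have "(a, b) \<in> one_runs ?s \<longleftrightarrow> a = 0 \<and> b = j"
    proof
      assume r: "(a, b) \<in> one_runs ?s"
      then have le: "a \<le> b" "b \<le> length ?s" by (auto simp: one_runs_def)
      have "a = 0"
        using r True nth[of "a - 1"] by (auto simp: one_runs_def)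
      moreover have "\<not> j < b"
        using r True nth[of j] by (auto simp: one_runs_def)
      moreover have "\<not> b < j"
        using r True nth[of b] by (auto simp: one_runs_def)
      ultimately show "a = 0 \<and> b = j" by simp
    next
      assume "a = 0 \<and> b = j"
      then show "(a, b) \<in> one_runs ?s" by (auto simp: one_runs_def nth)
    qed
    then show ?thesis using True by auto
  next
    case False
    define a' where "a' = a - Suc j"
    define b' where "b' = b - Suc j"
    have a: "a = a' + Suc j" using False by (simp add: a'_def)
    show ?thesis
    proof (cases "j < b")
      case True
      then have b: "b = b' + Suc j" by (simp add: b'_def)
      have shift: "?s ! (i + Suc j) = t ! i" for i
        by (simp add: nth_append)
      have ones: "(\<forall>l. a \<le> l \<and> l < b \<longrightarrow> ?s ! l) \<longleftrightarrow> (\<forall>l. a' \<le> l \<and> l < b' \<longrightarrow> t ! l)"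
      proof (intro iffI allI impI)
        fix l assume "\<forall>l. a \<le> l \<and> l < b \<longrightarrow> ?s ! l" "a' \<le> l \<and> l < b'"
        then have "?s ! (l + Suc j)" unfolding a b by simp
        then show "t ! l" by (simp only: shift)
      next
        fix l assume *: "\<forall>l. a' \<le> l \<and> l < b' \<longrightarrow> t ! l" "a \<le> l \<and> l < b"
        then have "Suc j \<le> l" unfolding a by simp
        then obtain l' where l: "l = l' + Suc j" using le_Suc_ex add.commute by metis
        then have "t ! l'" using * unfolding a b by simp
        then show "?s ! l" unfolding l shift .
      qed
      have before: "(a = 0 \<or> \<not> ?s ! (a - 1)) \<longleftrightarrow> (a' = 0 \<or> \<not> t ! (a' - 1))"
        by (cases a') (simp_all add: a nth_append)
      have after: "(b = length ?s \<or> \<not> ?s ! b) \<longleftrightarrow> (b' = length t \<or> \<not> t ! b')"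
        by (simp add: b nth_append)
      have "(a, b) \<in> one_runs ?s \<longleftrightarrow> (a', b') \<in> one_runs t"
        unfolding one_runs_def mem_Collect_eq prod.case ones before after
        by (simp add: a b)
      also have "\<dots> \<longleftrightarrow> (a, b) \<in> ?R"
        by (auto simp: a b)
      finally show ?thesis .
    next
      case False': False
      then show ?thesis using False by (auto simp: one_runs_def)
    qed
  qed
qed

lemma num_runs_between_replicate_True:
  "num_runs_between kl ku (replicate n True) = of_bool (kl \<le> n \<and> n \<le> ku)"
proof -
  have "{(i, j) \<in> {(0, n)}. kl \<le> j - i \<and> j - i \<le> ku} =
      (if kl \<le> n \<and> n \<le> ku then {(0, n)} else {})"
    by auto
  then show ?thesis
    by (simp add: num_runs_between_def one_runs_replicate_True)
qed

lemma num_runs_between_block: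
  "num_runs_between kl ku (replicate j True @ False # t) =
     of_bool (kl \<le> j \<and> j \<le> ku) + num_runs_between kl ku t"
proof -
  let ?f = "\<lambda>(a, b). (a + Suc j, b + Suc j)"
  let ?A = "{(a, b) \<in> one_runs t. kl \<le> b - a \<and> b - a \<le> ku}"
  have "inj_on ?f ?A" by (auto simp: inj_on_def)
  then have "card (?f ` ?A) = num_runs_between kl ku t"
    unfolding num_runs_between_def by (rule card_image)
  moreover have "finite (?f ` ?A)"
    by (rule finite_imageI, rule finite_subset[OF _ finite_one_runs[of t]]) auto
  moreover have "(0, j) \<notin> ?f ` ?A" by auto
  moreover have "{(a, b) \<in> one_runs (replicate j True @ False # t). kl \<le> b - a \<and> b - a \<le> ku} =
      (if kl \<le> j \<and> j \<le> ku then {(0, j)} else {}) \<union> ?f ` ?A"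
    unfolding one_runs_block by (auto simp: image_iff)
  ultimately show ?thesis by (simp add: num_runs_between_def)
qed

lemma finite_lists_bool_length: "finite {s :: bool list. length s = n}"
  using finite_lists_length_eq[of "UNIV :: bool set" n] by simp

lemma sum_bool_lists_Suc:
  fixes f :: "bool list \<Rightarrow> int"
  shows "(\<Sum>s | length s = Suc n. f s) =
    (\<Sum>s | length s = n. f (True # s)) + (\<Sum>s | length s = n. f (False # s))"
proof -
  let ?L = "\<lambda>n. {s :: bool list. length s = n}"
  have split: "?L (Suc n) = (#) True ` ?L n \<union> (#) False ` ?L n"
    by (auto simp: length_Suc_conv image_iff)
  have "(\<Sum>s\<in>?L (Suc n). f s) = (\<Sum>s\<in>(#) True ` ?L n. f s) + (\<Sum>s\<in>(#) False ` ?L n. f s)"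
    unfolding split
    by (rule sum.union_disjoint) (auto intro: finite_imageI finite_lists_bool_length)
  then show ?thesis by (simp add: sum.reindex inj_on_def)
qed

text \<open>Stating the decomposition by the first zero as an identity between sums of an arbitrary
  function lets the induction on the length apply to \<open>s \<mapsto> f (True # s)\<close>, and avoids any separate
  argument that the cases are disjoint.\<close>

lemma sum_bool_lists_first_block:
  fixes f :: "bool list \<Rightarrow> int"
  shows "(\<Sum>s | length s = n. f s) =
    f (replicate n True) + (\<Sum>j<n. \<Sum>t | length t = n - Suc j. f (replicate j True @ False # t))"
proof (induction n arbitrary: f)
  case 0
  then show ?case by simp
next
  case (Suc n)
  show ?case
    unfolding sum_bool_lists_Suc Suc.IH[of "\<lambda>s. f (True # s)"]
    by (subst sum.lessThan_Suc_shift) simp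
qed

lemma int_num_strings:
  "int (num_strings kl ku n m) =
     (\<Sum>s | length s = n. of_bool (num_runs_between kl ku s = m))"
  unfolding num_strings_def
  by (simp add: sum.If_cases of_bool_def finite_lists_bool_length Collect_conj_eq)

text \<open>As no string has a negative number of runs, the sum on the right also gives the conventional
  value 0 for \<open>m < 0\<close>; at \<open>n = 0\<close> the convention agrees with the actual count for the empty string,
  whose only run is null. This form of \<open>w\<close> needs no case distinction on \<open>m\<close>, so \<open>m\<close> may be shifted freely.\<close>

lemma w_eq_sum:
  "w kl ku (int n) m = (\<Sum>s | length s = n. of_bool (int (num_runs_between kl ku s) = m))"
proof (cases "m < 0")
  case True
  then show ?thesis by (simp add: w_def)
next
  case m: False
  show ?thesis
  proof (cases "n = 0")
    case True
    then show ?thesis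
      using m num_runs_between_replicate_True[of kl ku 0] by (auto simp: w_def)
  next
    case False
    have "int (num_runs_between kl ku s) = m \<longleftrightarrow> num_runs_between kl ku s = nat m" for s
      using m by auto
    then show ?thesis using m False by (simp add: w_def int_num_strings)
  qed
qed

lemma w_first_block:
  "w kl ku (int n) m = (\<Sum>j\<le>n. w kl ku (int n - int j - 1) (m - of_bool (kl \<le> j \<and> j \<le> ku)))"
proof -
  let ?r = "\<lambda>j. of_bool (kl \<le> j \<and> j \<le> ku) :: int"
  have rest: "(\<Sum>t | length t = n - Suc j.
        of_bool (int (num_runs_between kl ku (replicate j True @ False # t)) = m)) =
      w kl ku (int n - int j - 1) (m - ?r j)" if "j < n" for j
  proof -
    have "int n - int j - 1 = int (n - Suc j)" using that by simp
    moreover have "int (num_runs_between kl ku (replicate j True @ False # t)) = m \<longleftrightarrow>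
        int (num_runs_between kl ku t) = m - ?r j" for t
      by (auto simp: num_runs_between_block)
    ultimately show ?thesis by (simp only: w_eq_sum)
  qed
  \<comment> \<open>The string without zeros is the term \<open>j = n\<close>, in which \<open>w\<close> is taken at \<open>-1\<close>.\<close>
  have "of_bool (int (num_runs_between kl ku (replicate n True)) = m) = w kl ku (- 1) (m - ?r n)"
    by (auto simp: num_runs_between_replicate_True w_def)
  moreover have "(\<Sum>j<n. \<Sum>t | length t = n - Suc j.
        of_bool (int (num_runs_between kl ku (replicate j True @ False # t)) = m)) =
      (\<Sum>j<n. w kl ku (int n - int j - 1) (m - ?r j))"
    by (rule sum.cong[OF refl]) (simp only: rest lessThan_iff)
  moreover have "w kl ku (int n) m =
      of_bool (int (num_runs_between kl ku (replicate n True)) = m) +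
      (\<Sum>j<n. \<Sum>t | length t = n - Suc j.
        of_bool (int (num_runs_between kl ku (replicate j True @ False # t)) = m))"
    unfolding w_eq_sum by (rule sum_bool_lists_first_block)
  moreover have "{..n} = insert n {..<n}" by auto
  ultimately show ?thesis by simp
qed

text \<open>The two jumps of the indicator of \<open>[kl, ku]\<close> may lie beyond the range of summation; the
  corresponding correction terms are then values of \<open>w\<close> at first arguments below \<open>-1\<close>, where \<open>w\<close>
  vanishes. So no relation between \<open>n\<close>, \<open>kl\<close> and \<open>ku\<close> has to be distinguished.\<close>

lemma w_recurrence:
  assumes "kl \<le> ku"
  shows "w kl ku (int (Suc n)) m =
        2 * w kl ku (int n) m
        + w kl ku (int n - int kl) (m - 1) - w kl ku (int n - int kl) m
        - w kl ku (int n - int ku - 1) (m - 1) + w kl ku (int n - int ku - 1) m"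
proof -
  define r where "r j = (of_bool (kl \<le> j \<and> j \<le> ku) :: int)" for j
  \<comment> \<open>This is \<open>r (j - 1)\<close> with \<open>r (-1)\<close> read as 0; truncated subtraction would give \<open>r 0\<close> at \<open>j = 0\<close>.\<close>
  define r' where "r' j = (of_bool (kl < j \<and> j \<le> Suc ku) :: int)" for j
  define g where "g j d = w kl ku (int n - int j) (m - d)" for j d
  have "w kl ku (int (Suc n)) m = (\<Sum>j\<le>Suc n. g j (r j))"
    by (subst w_first_block) (simp add: g_def r_def)
  moreover have "w kl ku (int n) m + w kl ku (int n) m = (\<Sum>j\<le>Suc n. g j (r' j))"
  proof -
    have "w kl ku (int n) m = (\<Sum>j\<le>n. g (Suc j) (r' (Suc j)))"
      by (subst w_first_block) (simp add: g_def r'_def less_Suc_eq_le algebra_simps)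
    moreover have "w kl ku (int n) m = g 0 (r' 0)"
      by (simp add: g_def r'_def)
    ultimately show ?thesis by (simp only: sum.atMost_Suc_shift)
  qed
  moreover have "(\<Sum>j\<le>Suc n. g j (r j)) - (\<Sum>j\<le>Suc n. g j (r' j)) =
      (g kl 1 - g kl 0) - (g (Suc ku) 1 - g (Suc ku) 0)"
  proof -
    have jump: "g j (r j) - g j (r' j) =
        (if kl = j then g j 1 - g j 0 else 0) - (if Suc ku = j then g j 1 - g j 0 else 0)" for j
      using assms by (auto simp: r_def r'_def)
    have outside: "g j d = 0" if "Suc n < j" for j d
      using that by (simp add: g_def w_def)
    show ?thesis
      unfolding sum_subtractf[symmetric] jump
      by (simp add: sum_subtractf sum.delta' outside del: sum.atMost_Suc)
  qed
  ultimately show ?thesis by (simp add: g_def algebra_simps)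
qed

theorem mainTheorem3:
  fixes kl ku :: nat
  assumes "kl \<le> ku"
  shows "(\<forall>n m :: int. n \<ge> 1 \<and> m \<ge> 0 \<longrightarrow>
      w kl ku n m =
        2 * w kl ku (n - 1) m
        + w kl ku (n - (int kl + 1)) (m - 1) - w kl ku (n - (int kl + 1)) m
        - w kl ku (n - (int ku + 2)) (m - 1) + w kl ku (n - (int ku + 2)) m)
    \<and> (\<forall>n m :: int. n \<ge> 1 \<and> m \<ge> 0 \<longrightarrow>
      w kl ku n m = int (num_strings kl ku (nat n) (nat m)))
    \<and> (\<forall>m :: int. w kl ku (-1) m = (if m = 0 then 1 else 0))
    \<and> (\<forall>m :: int. w kl ku 0 m =
        (if (m = 1 \<and> kl = 0) \<or> (m = 0 \<and> kl \<ge> 1) then 1 else 0))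
    \<and> (\<forall>n m :: int. n < -1 \<or> m < 0 \<longrightarrow> w kl ku n m = 0)"
proof (intro conjI allI impI)
  fix n m :: int
  assume "n \<ge> 1 \<and> m \<ge> 0"
  then have "n = int (Suc (nat (n - 1)))" by simp
  then obtain k where n: "n = int (Suc k)" ..
  show "w kl ku n m =
        2 * w kl ku (n - 1) m
        + w kl ku (n - (int kl + 1)) (m - 1) - w kl ku (n - (int kl + 1)) m
        - w kl ku (n - (int ku + 2)) (m - 1) + w kl ku (n - (int ku + 2)) m"
    using w_recurrence[OF assms, of k m] unfolding n by (simp add: algebra_simps)
qed (auto simp: w_def)

end
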